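(* Let $\mathcal M$ be a mixture of $d=\mathrm{poly}(n)$ binomial distributions: a sample is drawn from $\mathrm{Bin}(a_t,q)$ with probability $\alpha_t$, $t=1,\dots,d$, where $0\le a_1,\dots,a_d\le a$ are distinct integers, each $\alpha_t$ has $\mathrm{poly}(n)$-precision, and $q=\Omega(\sqrt{a^{-1}\log n})$. Then $\exp\big(O((a/q)^{1/3}\log^{2/3} n)\big)$ independent samples from $\mathcal M$ suffice to learn the parameters $(a_t,\alpha_t)_t$ exactly with high probability.
   Context: A number $x$ has $t$-precision if $10^{y}x\in\mathbb Z$ for some integer $y=O(\log t)$; "$\mathrm{poly}(n)$-precision" means $t$-precision for some $t$ polynomial in $n$. $\mathrm{Bin}(a,q)$ is the binomial distribution with $a$ trials and success probability $q$. "With high probability" means with probability at least $1-o(1)$ as $n\to\infty$. *)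

theory Defs
  imports "HOL-Probability.Probability"
begin

text \<open>The constant \<open>C\<close> is the one hidden in the bound \<open>y = O(log t)\<close>.\<close>

definition has_precision :: "real \<Rightarrow> real \<Rightarrow> real \<Rightarrow> bool" where
  "has_precision C t x \<longleftrightarrow> (\<exists>y::int. \<bar>real_of_int y\<bar> \<le> C * ln t \<and> 10 powi y * x \<in> \<int>)"

text \<open>
  The parameters of a mixture with \<open>d\<close> components form a list of \<open>d\<close> pairs \<open>(a\<^sub>t, \<alpha>\<^sub>t)\<close>.
  Weights are required to be strictly positive: a component of weight \<open>0\<close> leaves no trace in the
  samples, so its first entry would not be determined by the distribution.
\<close>

definition mixture_params :: "nat \<Rightarrow> (nat \<times> real) list \<Rightarrow> bool" where
  "mixture_params a ps \<longleftrightarrow> pmf_of_list_wf ps \<and> distinct (map fst ps) \<and>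
     (\<forall>(b, \<alpha>) \<in> set ps. b \<le> a \<and> 0 < \<alpha>)"

definition binomial_mixture :: "real \<Rightarrow> (nat \<times> real) list \<Rightarrow> nat pmf" where
  "binomial_mixture q ps = bind_pmf (pmf_of_list ps) (\<lambda>b. binomial_pmf b q)"

end

(*
  The generating function of the mixture at z is the polynomial with coefficients alpha_t and
  exponents a_t evaluated at w = 1 - q + q z.  The difference of two such polynomials has
  coefficients of absolute sum at most 2, and the nonzero ones are at least 1 / poly(n); multiplying
  N rotated copies and applying the maximum principle shows that its modulus exceeds
  exp (- O(N log n)) somewhere on the arc |arg w| <= pi / N.  On this arc |z|^2 <= 1 + (pi / (N q))^2,
  so that E |z|^(2 X) <= exp (a pi^2 / (q N^2)), which bounds the variance of the empirical generating
  function.  The two exponents balance at N = (a / (q log n))^(1/3), and the lower bound on q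
  keeps this quantity away from 0.
*)

theory Submission
  imports Defs "HOL-Complex_Analysis.Conformal_Mappings"
begin

section \<open>Lower bounds for polynomials on an arc of the unit circle\<close>

text \<open>The \<open>N\<close> rotations of a point are spaced by \<open>2 * pi / N\<close> in
  angle, so the one nearest to \<open>1\<close> is off by at most half a step.\<close>

lemma rotate_into_arc:
  assumes "N > 0" "norm z = 1"
  obtains k \<theta> where "k < N" "\<bar>\<theta>\<bar> \<le> pi / N" "z * cis (2 * pi * real k / real N) = cis \<theta>"
proof -
  define \<phi> where "\<phi> = Arg z"
  have z: "z = cis \<phi>"
    using assms(2) by (metis \<phi>_def cis_Arg div_by_1 norm_zero of_real_1 sgn_eq zero_neq_one)
  \<comment> \<open>\<open>i\<close> is the number of rotation steps that brings the angle
    \<open>\<phi>\<close> closest to \<open>0\<close>. It may be negative, so its residue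
    \<open>k\<close> modulo \<open>N\<close> serves as the index.\<close>
  define i where "i = round (- \<phi> * N / (2 * pi))"
  define k where "k = nat (i mod int N)"
  define \<theta> where "\<theta> = \<phi> + 2 * pi * i / N"
  have k: "int k = i mod int N" "k < N"
    using assms(1) by (auto simp: k_def nat_less_iff)
  have "\<bar>of_int i - (- \<phi> * N / (2 * pi))\<bar> \<le> 1 / 2"
    unfolding i_def by (rule of_int_round_abs_le)
  then have "\<bar>(of_int i - (- \<phi> * N / (2 * pi))) * (2 * pi / N)\<bar> \<le> 1 / 2 * (2 * pi / N)"
    unfolding abs_mult by (intro mult_mono) auto
  moreover have "(of_int i - (- \<phi> * N / (2 * pi))) * (2 * pi / N) = \<theta>"
    using assms(1) by (simp add: \<theta>_def field_simps)
  moreover have "1 / 2 * (2 * pi / N) = pi / N"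
    by simp
  ultimately have "\<bar>\<theta>\<bar> \<le> pi / N"
    by metis
  moreover have "i = int N * (i div int N) + int k"
    using k by simp
  then have "real_of_int i = real N * of_int (i div int N) + real k"
    by (metis of_int_add of_int_mult of_int_of_nat_eq)
  then have "\<theta> = (\<phi> + 2 * pi * real k / real N) + 2 * pi * of_int (i div int N)"
    using assms(1) by (simp add: \<theta>_def field_simps)
  then have "cis \<theta> = z * cis (2 * pi * real k / real N)"
    by (simp only: z cis_mult[symmetric] cis_multiple_2pi[OF Ints_of_int] mult_1_right)
  ultimately show ?thesis
    using that k(2) by metis
qed

text \<open>
  The product of the \<open>N\<close> rotations of \<open>f\<close> by multiples of \<open>2 * pi / N\<close> has modulus
  \<open>norm (f 0) ^ N\<close> at the origin, and on the unit circle one of its factors is evaluated on the arc.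
\<close>
lemma holomorphic_lower_bound_on_arc:
  fixes f :: "complex \<Rightarrow> complex"
  assumes holo: "f holomorphic_on UNIV"
    and bound: "\<And>z. norm z = 1 \<Longrightarrow> norm (f z) \<le> 2"
    and "0 < \<eta>" "\<eta> \<le> norm (f 0)" "N > 0"
  obtains \<theta> where "\<bar>\<theta>\<bar> \<le> pi / N" "(\<eta> / 2) ^ N \<le> norm (f (cis \<theta>))"
proof (rule ccontr)
  note arc = that
  assume "\<not> thesis"
  then have small: "norm (f (cis \<theta>)) \<le> (\<eta> / 2) ^ N" if "\<bar>\<theta>\<bar> \<le> pi / N" for \<theta>
    using that \<open>\<not> thesis\<close> arc by (meson linear)
  define F where "F z = (\<Prod>k<N. f (z * cis (2 * pi * real k / real N)))" for z
  have holF: "F holomorphic_on UNIV"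
    unfolding F_def
    by (intro holomorphic_on_prod holomorphic_on_compose_gen[OF _ holo, unfolded o_def]
        holomorphic_intros) auto
  \<comment> \<open>The factor on the arc contributes \<open>(\<eta> / 2) ^ N\<close> and each of
    the other \<open>N - 1\<close> at most \<open>2\<close>. The product
    \<open>\<eta> ^ N / 2\<close> falls short of the lower bound \<open>\<eta> ^ N\<close> for the
    modulus at the origin.\<close>
  have "norm (F 0) \<le> (\<eta> / 2) ^ N * 2 ^ (N - 1)"
  proof (rule maximum_modulus_frontier[of F "cball 0 1"])
    show "F holomorphic_on interior (cball 0 1)"
      using holF holomorphic_on_subset by blast
    show "continuous_on (closure (cball 0 1)) F"
      using holF holomorphic_on_imp_continuous_on continuous_on_subset by blast
    fix z :: complex
    assume "z \<in> frontier (cball 0 1)"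
    then have z: "norm z = 1"
      by simp
    obtain k \<theta> where k: "k < N" "\<bar>\<theta>\<bar> \<le> pi / N" "z * cis (2 * pi * real k / real N) = cis \<theta>"
      using rotate_into_arc[OF \<open>N > 0\<close> z] .
    have "norm (F z) = norm (f (cis \<theta>)) *
        (\<Prod>k\<in>{..<N} - {k}. norm (f (z * cis (2 * pi * real k / real N))))"
      using k by (simp add: F_def prod_norm[symmetric] prod.remove[of _ k] norm_mult)
    also have "\<dots> \<le> (\<eta> / 2) ^ N * (\<Prod>k\<in>{..<N} - {k}. 2)"
      using small[OF k(2)] \<open>0 < \<eta>\<close>
      by (intro mult_mono prod_mono prod_nonneg) (auto intro!: bound simp: norm_mult z)
    also have "\<dots> = (\<eta> / 2) ^ N * 2 ^ (N - 1)"
      using k by simp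
    finally show "norm (F z) \<le> (\<eta> / 2) ^ N * 2 ^ (N - 1)" .
  qed auto
  moreover have "norm (F 0) = norm (f 0) ^ N"
    by (simp add: F_def norm_power)
  moreover have "(\<eta> / 2) ^ N * 2 ^ (N - 1) = \<eta> ^ N / 2"
    using \<open>N > 0\<close> by (cases N) (auto simp: power_divide)
  moreover have "\<eta> ^ N \<le> norm (f 0) ^ N"
    using assms by (intro power_mono) auto
  moreover have "\<eta> ^ N > 0"
    using assms by simp
  ultimately show False
    by linarith
qed

text \<open>Dividing by \<open>z ^ s\<close>, with \<open>s\<close> the lowest exponent that occurs,
  leaves the modulus on the unit circle unchanged and makes the value at the origin a nonzero
  coefficient, hence of modulus at least \<open>\<eta>\<close>.\<close>

lemma polynomial_lower_bound_on_arc: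
  fixes c :: "nat \<Rightarrow> complex"
  assumes sum: "(\<Sum>b\<le>a. norm (c b)) \<le> 2"
    and gap: "\<And>b. b \<le> a \<Longrightarrow> c b \<noteq> 0 \<Longrightarrow> \<eta> \<le> norm (c b)"
    and nonzero: "\<exists>b\<le>a. c b \<noteq> 0" and "0 < \<eta>" "N > 0"
  obtains \<theta> where "\<bar>\<theta>\<bar> \<le> pi / N" "(\<eta> / 2) ^ N \<le> norm (\<Sum>b\<le>a. c b * cis \<theta> ^ b)"
proof -
  define s where "s = (LEAST b. b \<le> a \<and> c b \<noteq> 0)"
  have s: "s \<le> a" "c s \<noteq> 0"
    using LeastI_ex[OF nonzero] unfolding s_def by auto
  have below: "c b = 0" if "b < s" for b
    using not_less_Least[of b "\<lambda>b. b \<le> a \<and> c b \<noteq> 0"] s that unfolding s_def by auto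
  define f where "f z = (\<Sum>b\<in>{s..a}. c b * z ^ (b - s))" for z
  have shift: "(\<Sum>b\<le>a. c b * z ^ b) = z ^ s * f z" for z
  proof -
    have "(\<Sum>b\<le>a. c b * z ^ b) = (\<Sum>b\<in>{s..a}. c b * z ^ b)"
      using below by (intro sum.mono_neutral_right) auto
    also have "\<dots> = z ^ s * f z"
      unfolding f_def sum_distrib_left
      by (intro sum.cong) (auto simp: power_add[symmetric] mult.left_commute)
    finally show ?thesis .
  qed
  have "f 0 = c s"
    using s by (simp add: f_def sum.atLeast_Suc_atMost power_0_left)
  moreover have "norm (f z) \<le> 2" if "norm z = 1" for z
  proof -
    have "norm (f z) \<le> (\<Sum>b\<in>{s..a}. norm (c b))"
      unfolding f_def by (rule sum_norm_le) (simp add: norm_mult norm_power that)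
    also have "\<dots> \<le> (\<Sum>b\<le>a. norm (c b))"
      by (rule sum_mono2) auto
    finally show ?thesis
      using sum by linarith
  qed
  moreover have "f holomorphic_on UNIV"
    unfolding f_def by (intro holomorphic_intros)
  ultimately obtain \<theta> where "\<bar>\<theta>\<bar> \<le> pi / N" "(\<eta> / 2) ^ N \<le> norm (f (cis \<theta>))"
    using holomorphic_lower_bound_on_arc[of f \<eta> N] gap s \<open>0 < \<eta>\<close> \<open>N > 0\<close> by metis
  then show ?thesis
    using that by (simp add: shift norm_mult norm_power)
qed

section \<open>Generating functions of binomial mixtures\<close>

text \<open>The bounded point is the one that \<open>z \<mapsto> 1 - q + q z\<close> sends to
  \<open>cis \<theta>\<close>. The preimage of the unit circle is tangent to the unit circle at
  \<open>1\<close>, so the excess is only quadratic in \<open>\<theta>\<close>.\<close>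

lemma norm_preimage_arc_le:
  fixes q \<theta> :: real
  assumes "0 < q" "q \<le> 1"
  shows "(norm ((cis \<theta> - 1 + of_real q) / of_real q))\<^sup>2 \<le> 1 + \<theta>\<^sup>2 / q\<^sup>2"
proof -
  have "cos \<theta> \<ge> 1 - \<theta>\<^sup>2 / 2"
  proof -
    have "\<bar>sin (\<theta> / 2)\<bar> \<le> \<bar>\<theta> / 2\<bar>"
      by (rule abs_sin_x_le_abs_x)
    then have "(sin (\<theta> / 2))\<^sup>2 \<le> (\<theta> / 2)\<^sup>2"
      using abs_le_square_iff by blast
    moreover have "cos \<theta> = 1 - 2 * (sin (\<theta> / 2))\<^sup>2"
      using cos_double_sin[of "\<theta> / 2"] by simp
    ultimately show ?thesis
      by (simp add: power_divide)
  qed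
  then have "2 * (1 - q) * (1 - cos \<theta>) \<le> 2 * 1 * (\<theta>\<^sup>2 / 2)"
    using assms by (intro mult_mono) auto
  moreover have "(norm (cis \<theta> - 1 + of_real q))\<^sup>2 = q\<^sup>2 + 2 * (1 - q) * (1 - cos \<theta>)"
    unfolding cmod_power2 using sin_cos_squared_add[of \<theta>]
    by (simp add: power2_eq_square algebra_simps)
  ultimately show ?thesis
    using assms by (simp add: norm_divide power_divide field_simps)
qed

lemma binomial_pmf_generating_function:
  fixes z :: "'a :: real_normed_field"
  assumes "0 \<le> q" "q \<le> 1" "b \<le> a"
  shows "(\<Sum>j\<le>a. of_real (pmf (binomial_pmf b q) j) * z ^ j) = (1 - of_real q + of_real q * z) ^ b"
proof -
  have "(\<Sum>j\<le>a. of_real (pmf (binomial_pmf b q) j) * z ^ j) =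
      (\<Sum>j\<le>b. of_real (pmf (binomial_pmf b q) j) * z ^ j)"
    using assms by (intro sum.mono_neutral_right) (auto simp: binomial_eq_0)
  also have "\<dots> = (\<Sum>j\<le>b. of_nat (b choose j) * (of_real q * z) ^ j * (1 - of_real q) ^ (b - j))"
    using assms by (intro sum.cong) (auto simp: power_mult_distrib)
  also have "\<dots> = (1 - of_real q + of_real q * z) ^ b"
    by (simp add: binomial_ring[symmetric] add.commute)
  finally show ?thesis .
qed

lemma pmf_bind_sum:
  assumes "set_pmf W \<subseteq> A" "finite A"
  shows "pmf (bind_pmf W f) j = (\<Sum>b\<in>A. pmf W b * pmf (f b) j)"
  unfolding pmf_bind using assms
  by (subst integral_measure_pmf_real[of A]) (auto simp: mult.commute)

text \<open>The field is left general because the identity serves twice: at a real point for the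
  moment bound and at a complex point for the separation.\<close>

lemma bind_binomial_generating_function:
  fixes z :: "'a :: real_normed_field"
  assumes "0 \<le> q" "q \<le> 1" "set_pmf W \<subseteq> {..a}"
  shows "(\<Sum>j\<le>a. of_real (pmf (bind_pmf W (\<lambda>b. binomial_pmf b q)) j) * z ^ j) =
    (\<Sum>b\<le>a. of_real (pmf W b) * (1 - of_real q + of_real q * z) ^ b)"
proof -
  have "(\<Sum>j\<le>a. of_real (pmf (bind_pmf W (\<lambda>b. binomial_pmf b q)) j) * z ^ j) =
      (\<Sum>j\<le>a. \<Sum>b\<le>a. of_real (pmf W b) * (of_real (pmf (binomial_pmf b q) j) * z ^ j))"
    by (simp add: pmf_bind_sum[OF assms(3)] sum_distrib_right mult.assoc del: pmf_binomial)
  also have "\<dots> = (\<Sum>b\<le>a. of_real (pmf W b) * (\<Sum>j\<le>a. of_real (pmf (binomial_pmf b q) j) * z ^ j))"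
    unfolding sum_distrib_left by (rule sum.swap)
  also have "\<dots> = (\<Sum>b\<le>a. of_real (pmf W b) * (1 - of_real q + of_real q * z) ^ b)"
    using assms by (intro sum.cong refl arg_cong2[where f = "(*)"] binomial_pmf_generating_function) auto
  finally show ?thesis .
qed

lemma set_bind_binomial_subset:
  assumes "0 \<le> q" "q \<le> 1" "set_pmf W \<subseteq> {..a}"
  shows "set_pmf (bind_pmf W (\<lambda>b. binomial_pmf b q)) \<subseteq> {..a}"
  using assms by (auto simp: set_pmf_binomial_eq split: if_splits)

text \<open>The moment is the generating function at the real point \<open>r\<close>. As
  \<open>1 - q + q * r\<close> is at least \<open>1\<close>, the largest exponent \<open>a\<close>
  is the worst case, and \<open>1 + x \<le> exp x\<close> finishes.\<close>

lemma bind_binomial_moment_le: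
  assumes "0 \<le> q" "q \<le> 1" "set_pmf W \<subseteq> {..a}" "1 \<le> r"
  shows "(\<Sum>j\<le>a. r ^ j * pmf (bind_pmf W (\<lambda>b. binomial_pmf b q)) j) \<le> exp (a * q * (r - 1))"
proof -
  have "(\<Sum>j\<le>a. r ^ j * pmf (bind_pmf W (\<lambda>b. binomial_pmf b q)) j) =
      (\<Sum>b\<le>a. pmf W b * (1 - q + q * r) ^ b)"
    using bind_binomial_generating_function[OF assms(1-3), of r] by (simp add: mult.commute)
  also have "\<dots> \<le> (\<Sum>b\<le>a. pmf W b * exp (a * q * (r - 1)))"
  proof (intro sum_mono mult_left_mono)
    fix b assume "b \<in> {..a}"
    have "1 \<le> 1 - q + q * r"
      using assms mult_left_mono[of 1 r q] by simp
    then have "(1 - q + q * r) ^ b \<le> (1 - q + q * r) ^ a"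
      using \<open>b \<in> {..a}\<close> by (intro power_increasing) auto
    also have "\<dots> \<le> exp (q * (r - 1)) ^ a"
      using exp_ge_add_one_self[of "q * (r - 1)"] \<open>1 \<le> 1 - q + q * r\<close>
      by (intro power_mono) (auto simp: algebra_simps)
    finally show "(1 - q + q * r) ^ b \<le> exp (a * q * (r - 1))"
      by (simp add: exp_of_nat_mult[symmetric] mult.assoc)
  qed auto
  also have "\<dots> = exp (a * q * (r - 1))"
    using sum_pmf_eq_1[of "{..a}" W] assms by (simp add: sum_distrib_right[symmetric])
  finally show ?thesis .
qed

text \<open>
  Weighting the squared differences by powers of \<open>r\<close> makes them control the difference of the
  generating functions on a disc of radius \<open>sqrt r\<close>, which contains the preimage of the arc under
  the substitution \<open>z \<mapsto> 1 - q + q z\<close>.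
\<close>
lemma bind_binomial_separation:
  fixes q :: real
  assumes q: "0 < q" "q \<le> 1" and W: "set_pmf W \<subseteq> {..a}" "set_pmf W' \<subseteq> {..a}" "W \<noteq> W'"
    and gap: "\<And>b. pmf W b \<noteq> pmf W' b \<Longrightarrow> \<eta> \<le> \<bar>pmf W b - pmf W' b\<bar>" and "0 < \<eta>" "N > 0"
  defines "P \<equiv> pmf (bind_pmf W (\<lambda>b. binomial_pmf b q))"
    and "P' \<equiv> pmf (bind_pmf W' (\<lambda>b. binomial_pmf b q))"
  shows "((\<eta> / 2) ^ N)\<^sup>2 / (a + 1) \<le> (\<Sum>j\<le>a. (1 + (pi / N)\<^sup>2 / q\<^sup>2) ^ j * (P j - P' j)\<^sup>2)"
proof -
  define r where "r = 1 + (pi / N)\<^sup>2 / q\<^sup>2"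
  define c where "c b = complex_of_real (pmf W b - pmf W' b)" for b
  have "(\<Sum>b\<le>a. norm (c b)) \<le> (\<Sum>b\<le>a. pmf W b + pmf W' b)"
    unfolding c_def norm_of_real by (rule sum_mono) (simp add: abs_le_iff add_increasing)
  also have "\<dots> = 2"
    using sum_pmf_eq_1[of "{..a}" W] sum_pmf_eq_1[of "{..a}" W'] W by (simp add: sum.distrib)
  finally have "(\<Sum>b\<le>a. norm (c b)) \<le> 2" .
  moreover have "\<exists>b\<le>a. c b \<noteq> 0"
  proof (rule ccontr)
    assume "\<not> ?thesis"
    then have "pmf W b = pmf W' b" for b
      using W by (cases "b \<le> a") (auto simp: c_def set_pmf_iff subset_iff, metis)
    then show False
      using W(3) pmf_eqI by blast
  qed
  ultimately obtain \<theta> where \<theta>: "\<bar>\<theta>\<bar> \<le> pi / N"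
      "(\<eta> / 2) ^ N \<le> norm (\<Sum>b\<le>a. c b * cis \<theta> ^ b)"
    using polynomial_lower_bound_on_arc[of c a \<eta> N] gap \<open>0 < \<eta>\<close> \<open>N > 0\<close>
    by (metis c_def norm_of_real of_real_0 right_minus_eq)
  \<comment> \<open>At this point the generating functions of the two mixtures become the
    polynomials with coefficients \<open>pmf W b\<close> and \<open>pmf W' b\<close> evaluated at
    \<open>cis \<theta>\<close>.\<close>
  define z where "z = (cis \<theta> - 1 + of_real q) / of_real q"
  have z: "1 - of_real q + of_real q * z = cis \<theta>"
    using q by (simp add: z_def)
  have "\<theta>\<^sup>2 \<le> (pi / N)\<^sup>2"
    using \<theta>(1) by (simp add: power2_le_iff_abs_le)
  then have "(norm z)\<^sup>2 \<le> r"
    using norm_preimage_arc_le[OF q, of \<theta>] divide_right_mono[of "\<theta>\<^sup>2" "(pi / N)\<^sup>2" "q\<^sup>2"]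
    unfolding z_def r_def by (smt (verit) zero_le_power2)
  have "(\<Sum>b\<le>a. c b * cis \<theta> ^ b) = (\<Sum>j\<le>a. of_real (P j) * z ^ j) - (\<Sum>j\<le>a. of_real (P' j) * z ^ j)"
    using q W unfolding P_def P'_def
    by (simp add: bind_binomial_generating_function z c_def sum_subtractf left_diff_distrib)
  also have "\<dots> = (\<Sum>j\<le>a. of_real (P j - P' j) * z ^ j)"
    by (simp add: sum_subtractf[symmetric] algebra_simps)
  finally have eq: "(\<Sum>b\<le>a. c b * cis \<theta> ^ b) = (\<Sum>j\<le>a. of_real (P j - P' j) * z ^ j)" .
  have "((\<eta> / 2) ^ N)\<^sup>2 \<le> (norm (\<Sum>b\<le>a. c b * cis \<theta> ^ b))\<^sup>2"
    using \<theta> \<open>0 < \<eta>\<close> by (intro power_mono) auto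
  also have "\<dots> \<le> (\<Sum>j\<le>a. \<bar>P j - P' j\<bar> * norm z ^ j)\<^sup>2"
    unfolding eq by (intro power_mono sum_norm_le) (auto simp: norm_mult norm_power simp del: of_real_diff)
  \<comment> \<open>Cauchy-Schwarz against the constant \<open>1\<close> is the source of the factor
    \<open>a + 1\<close>.\<close>
  also have "\<dots> \<le> (\<Sum>j\<le>a. (\<bar>P j - P' j\<bar> * norm z ^ j)\<^sup>2) * (a + 1)"
    using Cauchy_Schwarz_ineq_sum[of "\<lambda>j. \<bar>P j - P' j\<bar> * norm z ^ j" "\<lambda>_. 1" "{..a}"] by simp
  also have "\<dots> = (\<Sum>j\<le>a. ((norm z)\<^sup>2) ^ j * (P j - P' j)\<^sup>2) * (a + 1)"
    by (simp add: power_mult_distrib power_mult[symmetric] mult.commute)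
  also have "\<dots> \<le> (\<Sum>j\<le>a. r ^ j * (P j - P' j)\<^sup>2) * (a + 1)"
    using \<open>(norm z)\<^sup>2 \<le> r\<close> by (intro mult_right_mono sum_mono power_mono) auto
  finally show ?thesis
    by (simp add: r_def pos_divide_le_eq)
qed

section \<open>Second moments of empirical frequencies\<close>

lemma finite_set_replicate_pmf:
  assumes "finite (set_pmf p)"
  shows "finite (set_pmf (replicate_pmf m p))"
  using assms finite_lists_length_eq[of "set_pmf p" m]
  by (simp add: set_replicate_pmf lists_eq_set conj_commute)

lemma expectation_replicate_pmf_Suc:
  fixes h :: "'a list \<Rightarrow> real"
  assumes "finite (set_pmf p)"
  shows "measure_pmf.expectation (replicate_pmf (Suc m) p) h =
    (\<Sum>x\<in>set_pmf p. pmf p x * measure_pmf.expectation (replicate_pmf m p) (\<lambda>xs. h (x # xs)))"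
proof -
  have eq: "replicate_pmf (Suc m) p = bind_pmf p (\<lambda>x. map_pmf (\<lambda>xs. x # xs) (replicate_pmf m p))"
    by (simp add: map_pmf_def)
  show ?thesis
    unfolding eq using assms finite_set_replicate_pmf[OF assms]
    by (subst pmf_expectation_bind[of "set_pmf p"]) auto
qed

text \<open>Splitting off the first draw leaves a cross term that is a multiple of the mean of the
  remaining sum. The first claim makes it vanish, so both are proved in one induction.\<close>

lemma expectation_sum_list_centered:
  fixes f :: "'a \<Rightarrow> real"
  assumes fin: "finite (set_pmf p)" and zero: "(\<Sum>x\<in>set_pmf p. pmf p x * f x) = 0"
  shows "measure_pmf.expectation (replicate_pmf m p) (\<lambda>xs. sum_list (map f xs)) = 0"
    and "measure_pmf.expectation (replicate_pmf m p) (\<lambda>xs. (sum_list (map f xs))\<^sup>2) =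
      m * (\<Sum>x\<in>set_pmf p. pmf p x * (f x)\<^sup>2)"
proof (induction m)
  case 0
  { case 1 show ?case by simp next case 2 show ?case by simp }
next
  case (Suc m)
  note int = integrable_measure_pmf_finite[OF finite_set_replicate_pmf[OF fin]]
  have one: "(\<Sum>x\<in>set_pmf p. pmf p x) = 1"
    using fin by (intro sum_pmf_eq_1) auto
  { case 1
    show ?case
      unfolding expectation_replicate_pmf_Suc[OF fin] using Suc(1) zero
      by (simp add: Bochner_Integration.integral_add[OF int int])
  next
    case 2
    have "measure_pmf.expectation (replicate_pmf m p) (\<lambda>xs. (f x + sum_list (map f xs))\<^sup>2) =
        (f x)\<^sup>2 + m * (\<Sum>x\<in>set_pmf p. pmf p x * (f x)\<^sup>2)" for x
      using Suc by (simp add: power2_sum Bochner_Integration.integral_add[OF int int] mult.assoc)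
    then show ?case
      unfolding expectation_replicate_pmf_Suc[OF fin]
      by (simp add: distrib_left sum.distrib sum_distrib_right[symmetric] one)
        (simp add: algebra_simps)
  }
qed

text \<open>The variance \<open>p * (1 - p) / m\<close> is relaxed to \<open>p / m\<close>, which is
  linear in the probability: a weighted sum of these bounds is then a moment of the
  distribution.\<close>

lemma expectation_empirical_deviation:
  assumes fin: "finite (set_pmf p)" and "m > 0"
  shows "measure_pmf.expectation (replicate_pmf m p) (\<lambda>xs. (count_list xs j / m - pmf p j)\<^sup>2)
    \<le> pmf p j / m"
proof -
  define f where "f x = of_bool (x = j) - pmf p j" for x
  have one: "(\<Sum>x\<in>set_pmf p. pmf p x) = 1"
    using fin by (intro sum_pmf_eq_1) auto
  have pj: "(\<Sum>x\<in>set_pmf p. pmf p x * of_bool (x = j)) = pmf p j"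
    using fin by (simp add: of_bool_def if_distrib[of "(*) _"] pmf_eq_0_set_pmf sum.delta' cong: if_cong)
  have "(\<Sum>x\<in>set_pmf p. pmf p x * f x) = 0"
    by (simp add: f_def right_diff_distrib sum_subtractf pj sum_distrib_right[symmetric] one)
  note E = expectation_sum_list_centered(2)[OF fin this, of m]
  \<comment> \<open>The indicator equals its own square, so the expanded square is linear in
    it.\<close>
  have "(\<Sum>x\<in>set_pmf p. pmf p x * (f x)\<^sup>2) =
      (\<Sum>x\<in>set_pmf p. pmf p x * of_bool (x = j) * (1 - 2 * pmf p j) + pmf p x * (pmf p j)\<^sup>2)"
    by (intro sum.cong) (auto simp: f_def power2_eq_square algebra_simps)
  also have "\<dots> = pmf p j - (pmf p j)\<^sup>2"
    by (simp add: sum.distrib sum_distrib_right[symmetric] one pj)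
      (simp add: power2_eq_square algebra_simps)
  also have "\<dots> \<le> pmf p j"
    by simp
  finally have V: "(\<Sum>x\<in>set_pmf p. pmf p x * (f x)\<^sup>2) \<le> pmf p j" .
  have "sum_list (map f xs) = count_list xs j - length xs * pmf p j" for xs
    by (induction xs) (auto simp: f_def algebra_simps)
  then have "count_list xs j / m - pmf p j = sum_list (map f xs) / m"
    if "xs \<in> set_pmf (replicate_pmf m p)" for xs
    using that \<open>m > 0\<close> by (simp add: set_replicate_pmf diff_divide_distrib)
  then have "measure_pmf.expectation (replicate_pmf m p) (\<lambda>xs. (count_list xs j / m - pmf p j)\<^sup>2) =
      measure_pmf.expectation (replicate_pmf m p) (\<lambda>xs. (sum_list (map f xs))\<^sup>2 / m\<^sup>2)"
    by (intro integral_cong_AE) (auto simp: AE_measure_pmf_iff power_divide)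
  also have "\<dots> \<le> pmf p j / m"
    using E V \<open>m > 0\<close> by (simp add: power2_eq_square field_simps)
  finally show ?thesis .
qed

section \<open>Learning by minimum distance\<close>

text \<open>
  The learner returns the target of any parameter whose distribution is close to the empirical
  one in the weighted \<open>l\<^sup>2\<close> norm: a union bound over the parameters is not needed.
\<close>
lemma minimum_distance_learner:
  fixes P :: "'p \<Rightarrow> nat pmf" and target :: "'p \<Rightarrow> 'b" and w :: "nat \<Rightarrow> real"
  assumes supp: "\<And>\<theta>. \<theta> \<in> S \<Longrightarrow> set_pmf (P \<theta>) \<subseteq> {..a}" and w: "\<And>j. 0 \<le> w j"
    and moment: "\<And>\<theta>. \<theta> \<in> S \<Longrightarrow> (\<Sum>j\<le>a. w j * pmf (P \<theta>) j) \<le> V"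
    and sep: "\<And>\<theta> \<theta>'. \<theta> \<in> S \<Longrightarrow> \<theta>' \<in> S \<Longrightarrow> target \<theta> \<noteq> target \<theta>' \<Longrightarrow>
      \<Delta> \<le> (\<Sum>j\<le>a. w j * (pmf (P \<theta>) j - pmf (P \<theta>') j)\<^sup>2)"
    and "0 < \<Delta>" "m > 0"
  shows "\<exists>learner. \<forall>\<theta>\<in>S. 1 - 4 * V / (\<Delta> * m) \<le>
    measure_pmf.prob (replicate_pmf m (P \<theta>)) {xs. learner xs = target \<theta>}"
proof -
  define D where "D xs \<theta> = (\<Sum>j\<le>a. w j * (count_list xs j / m - pmf (P \<theta>) j)\<^sup>2)" for xs \<theta>
  \<comment> \<open>With threshold \<open>\<Delta> / 4\<close>, two close parameters have squared
    distance below \<open>2 * \<Delta> / 4 + 2 * \<Delta> / 4 = \<Delta>\<close>. If no parameter is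
    close, \<open>SOME\<close> is arbitrary; the true one is then not close either, an event covered
    by the Markov bound.\<close>
  define learner where "learner xs = target (SOME \<theta>. \<theta> \<in> S \<and> D xs \<theta> < \<Delta> / 4)" for xs
  have D_nonneg: "0 \<le> D xs \<theta>" for xs \<theta>
    unfolding D_def by (intro sum_nonneg mult_nonneg_nonneg w) auto
  have correct: "learner xs = target \<theta>" if "\<theta> \<in> S" "D xs \<theta> < \<Delta> / 4" for xs \<theta>
  proof -
    define \<theta>' where "\<theta>' = (SOME \<theta>. \<theta> \<in> S \<and> D xs \<theta> < \<Delta> / 4)"
    have \<theta>': "\<theta>' \<in> S" "D xs \<theta>' < \<Delta> / 4"
      using someI[of "\<lambda>\<theta>. \<theta> \<in> S \<and> D xs \<theta> < \<Delta> / 4" \<theta>] that unfolding \<theta>'_def by auto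
    have "(\<Sum>j\<le>a. w j * (pmf (P \<theta>) j - pmf (P \<theta>') j)\<^sup>2) \<le>
        (\<Sum>j\<le>a. w j * (2 * (count_list xs j / m - pmf (P \<theta>) j)\<^sup>2
          + 2 * (count_list xs j / m - pmf (P \<theta>') j)\<^sup>2))"
    proof (intro sum_mono mult_left_mono w)
      fix j
      have "(x - y)\<^sup>2 \<le> 2 * (u - x)\<^sup>2 + 2 * (u - y)\<^sup>2" for u x y :: real
        using zero_le_power2[of "2 * u - x - y"] by (simp add: power2_eq_square algebra_simps)
      then show "(pmf (P \<theta>) j - pmf (P \<theta>') j)\<^sup>2 \<le> 2 * (count_list xs j / m - pmf (P \<theta>) j)\<^sup>2
          + 2 * (count_list xs j / m - pmf (P \<theta>') j)\<^sup>2" .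
    qed
    also have "\<dots> = 2 * D xs \<theta> + 2 * D xs \<theta>'"
      by (simp add: D_def sum.distrib sum_distrib_left distrib_left mult.left_commute)
    also have "\<dots> < \<Delta>"
      using that \<theta>' by linarith
    finally have "target \<theta> = target \<theta>'"
      using sep[OF that(1) \<theta>'(1)] by linarith
    then show ?thesis
      by (simp add: learner_def \<theta>'_def)
  qed
  have "1 - 4 * V / (\<Delta> * m) \<le> measure_pmf.prob (replicate_pmf m (P \<theta>)) {xs. learner xs = target \<theta>}"
    if \<theta>: "\<theta> \<in> S" for \<theta>
  proof -
    let ?R = "replicate_pmf m (P \<theta>)"
    have fin: "finite (set_pmf (P \<theta>))"
      using supp[OF \<theta>] finite_subset by blast
    note int = integrable_measure_pmf_finite[OF finite_set_replicate_pmf[OF fin]]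
    have "measure_pmf.expectation ?R (\<lambda>xs. D xs \<theta>) =
        (\<Sum>j\<le>a. w j * measure_pmf.expectation ?R (\<lambda>xs. (count_list xs j / m - pmf (P \<theta>) j)\<^sup>2))"
      unfolding D_def by (subst Bochner_Integration.integral_sum) (auto intro: int)
    also have "\<dots> \<le> (\<Sum>j\<le>a. w j * (pmf (P \<theta>) j / m))"
      by (intro sum_mono mult_left_mono expectation_empirical_deviation fin w \<open>m > 0\<close>)
    also have "\<dots> = (\<Sum>j\<le>a. w j * pmf (P \<theta>) j) / m"
      by (simp add: sum_divide_distrib)
    also have "\<dots> \<le> V / m"
      by (intro divide_right_mono moment \<theta>) simp
    finally have E: "measure_pmf.expectation ?R (\<lambda>xs. D xs \<theta>) \<le> V / m" .
    have "measure_pmf.prob ?R {xs. \<Delta> / 4 \<le> D xs \<theta>} \<le> measure_pmf.expectation ?R (\<lambda>xs. D xs \<theta>) / (\<Delta> / 4)"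
      using integral_Markov_inequality_measure[OF int[of m "\<lambda>xs. D xs \<theta>"], of UNIV "\<Delta> / 4"]
        \<open>0 < \<Delta>\<close> D_nonneg by simp
    also have "\<dots> \<le> V / m / (\<Delta> / 4)"
      using E \<open>0 < \<Delta>\<close> by (intro divide_right_mono) auto
    also have "\<dots> = 4 * V / (\<Delta> * m)"
      by (simp add: field_simps)
    finally have "1 - 4 * V / (\<Delta> * m) \<le> measure_pmf.prob ?R (UNIV - {xs. \<Delta> / 4 \<le> D xs \<theta>})"
      using measure_pmf.prob_compl[of "{xs. \<Delta> / 4 \<le> D xs \<theta>}" "replicate_pmf m (P \<theta>)"] by simp
    also have "\<dots> \<le> measure_pmf.prob ?R {xs. learner xs = target \<theta>}"
      using correct[OF \<theta>] by (intro measure_pmf.finite_measure_mono) auto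
    finally show ?thesis .
  qed
  then show ?thesis
    by blast
qed

section \<open>Mixture parameters and the precision of the weights\<close>

lemma pmf_of_list_distinct:
  assumes "pmf_of_list_wf ps" "distinct (map fst ps)" "(b, \<alpha>) \<in> set ps"
  shows "pmf (pmf_of_list ps) b = \<alpha>"
proof -
  have "set (filter (\<lambda>z. fst z = b) ps) = {(b, \<alpha>)}"
    using assms(2,3) eq_key_imp_eq_value by fastforce
  moreover have "distinct (filter (\<lambda>z. fst z = b) ps)"
    using assms(2) by (auto simp: distinct_map)
  ultimately show ?thesis
    using assms(1) by (simp add: pmf_pmf_of_list sum_list_distinct_conv_sum_set)
qed

lemma mixture_params_set_pmf:
  assumes "mixture_params a ps"
  shows "set_pmf (pmf_of_list ps) = fst ` set ps"
  using assms unfolding mixture_params_def by (intro set_pmf_of_list_eq) auto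

text \<open>The mixing distribution determines the parameters up to order, so different parameter
  sets give different mixing distributions.\<close>

lemma mixture_params_set_eq:
  assumes "mixture_params a ps"
  shows "set ps = (\<lambda>b. (b, pmf (pmf_of_list ps) b)) ` set_pmf (pmf_of_list ps)"
proof -
  have "pmf (pmf_of_list ps) (fst x) = snd x" if "x \<in> set ps" for x
    using pmf_of_list_distinct[of ps "fst x" "snd x"] assms that by (simp add: mixture_params_def)
  then show ?thesis
    unfolding mixture_params_set_pmf[OF assms] image_image by simp
qed

text \<open>The exponent in \<open>has_precision\<close> varies with \<open>x\<close>. Further
  factors of \<open>10\<close> raise it to the largest admissible value, which gives all weights a
  common denominator.\<close>

lemma has_precision_scaled_Ints:
  assumes "has_precision C t x"
  shows "10 ^ nat \<lfloor>C * ln t\<rfloor> * x \<in> \<int>"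
proof -
  define Y where "Y = nat \<lfloor>C * ln t\<rfloor>"
  obtain y where y: "\<bar>real_of_int y\<bar> \<le> C * ln t" "10 powi y * x \<in> \<int>"
    using assms by (auto simp: has_precision_def)
  have "y \<le> int Y"
    using y(1) unfolding Y_def by (simp add: le_nat_floor le_floor_iff abs_le_iff)
  then have "(10::real) ^ Y = 10 ^ nat (int Y - y) * 10 powi y"
    using power_int_add[of "10::real" "int Y - y" y] by (simp add: power_int_def[of _ "int Y - y"])
  then have "10 ^ Y * x = 10 ^ nat (int Y - y) * (10 powi y * x)"
    by simp
  also have "\<dots> \<in> \<int>"
    by (intro Ints_mult[OF _ y(2)] Ints_power) auto
  finally show ?thesis
    by (simp add: Y_def)
qed

text \<open>Both probabilities are integer multiples of the same power of \<open>1 / 10\<close>;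
  outside the support the multiple is \<open>0\<close>.\<close>

lemma mixture_weights_gap:
  assumes "mixture_params a ps" "\<forall>(b, \<alpha>)\<in>set ps. has_precision C t \<alpha>"
    and "mixture_params a' ps'" "\<forall>(b, \<alpha>)\<in>set ps'. has_precision C t \<alpha>"
    and "pmf (pmf_of_list ps) b \<noteq> pmf (pmf_of_list ps') b"
  shows "1 / 10 ^ nat \<lfloor>C * ln t\<rfloor> \<le> \<bar>pmf (pmf_of_list ps) b - pmf (pmf_of_list ps') b\<bar>"
proof -
  let ?s = "10 ^ nat \<lfloor>C * ln t\<rfloor> :: real"
  have int: "?s * pmf (pmf_of_list qs) b \<in> \<int>"
    if "mixture_params a'' qs" "\<forall>(b, \<alpha>)\<in>set qs. has_precision C t \<alpha>" for a'' qs
  proof (cases "b \<in> set_pmf (pmf_of_list qs)")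
    case True
    then have "(b, pmf (pmf_of_list qs) b) \<in> set qs"
      using mixture_params_set_eq[OF that(1)] by blast
    then show ?thesis
      using that(2) has_precision_scaled_Ints by blast
  qed (simp add: set_pmf_iff)
  have "?s * (pmf (pmf_of_list ps) b - pmf (pmf_of_list ps') b) \<in> \<int>"
    unfolding right_diff_distrib by (intro Ints_diff int[OF assms(1,2)] int[OF assms(3,4)])
  then have "1 \<le> \<bar>?s * (pmf (pmf_of_list ps) b - pmf (pmf_of_list ps') b)\<bar>"
    using assms(5) by (intro Ints_nonzero_abs_ge1) auto
  then show ?thesis
    by (simp add: abs_mult pos_divide_le_eq mult.commute)
qed

section \<open>Balancing the exponents\<close>

text \<open>
  With \<open>N\<close> of order \<open>(a / (q * ln n)) powr (1/3)\<close>, both the moment bound, of order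
  \<open>exp (a / (q * N\<^sup>2))\<close>, and the separation, of order \<open>exp (- N * ln n)\<close>, are controlled by the
  exponent \<open>T\<close> of the sample size.
\<close>
lemma sample_size_estimate:
  fixes c \<kappa> q :: real and n a :: nat
  assumes hyps: "0 < c" "0 \<le> \<kappa>" "2 \<le> n" "1 \<le> a" "0 < q" "q \<le> 1" "c * sqrt (ln n / a) \<le> q"
  defines "T \<equiv> (a / q) powr (1/3) * ln n powr (2/3)"
    and "K \<equiv> 34 + 1 / c powr (2/3) + 2 * \<kappa> * (1 + 1 / c powr (2/3))"
  obtains N :: nat where "N > 0" "0 < T"
    "8 * real n * real (a + 1) * exp (a * (pi / N)\<^sup>2 / q) * exp (2 * N * (\<kappa> * ln n)) \<le> exp (K * T)"
proof -
  define L where "L = ln (real n)"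
  define s where "s = c powr (2/3)"
  define X where "X = (a / (q * L)) powr (1/3)"
  define N where "N = nat \<lceil>X\<rceil>"
  have "1 / 2 \<le> ln (2::real)"
    using ln2_ge_two_thirds by linarith
  also have "\<dots> \<le> L"
    using hyps by (simp add: L_def)
  finally have L: "1 / 2 \<le> L" .
  have X: "0 < X" and s: "0 < s"
    using hyps L by (auto simp: X_def s_def)
  have X3: "X ^ 3 = a / (q * L)"
    using hyps L by (simp add: X_def powr_power)
  \<comment> \<open>Since \<open>X ^ 3 = a / (q * L)\<close>, both \<open>X * L\<close> and
    \<open>a / (q * X\<^sup>2)\<close> equal \<open>T\<close>: this is the balance behind the choice
    of \<open>X\<close>.\<close>
  have T: "T = X * L"
  proof -
    have "T = (a / q) powr (1/3) * L powr (1 - 1/3)"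
      by (simp add: T_def L_def)
    also have "\<dots> = (a / q) powr (1/3) / L powr (1/3) * L"
      using L by (subst powr_diff) simp
    also have "\<dots> = X * L"
      using hyps L by (simp add: X_def powr_divide powr_mult field_simps)
    finally show ?thesis .
  qed
  \<comment> \<open>The lower bound on \<open>q\<close> enters here:
    \<open>c\<^sup>2 * L / a \<le> q\<^sup>2 \<le> 1 / q\<close> rearranges to
    \<open>c\<^sup>2 \<le> X ^ 3\<close>.\<close>
  have "s \<le> X"
  proof -
    have "c\<^sup>2 * (L / a) = (c * sqrt (L / a))\<^sup>2"
      using hyps L by (simp add: power_mult_distrib)
    also have "\<dots> \<le> q\<^sup>2"
      using hyps L by (intro power_mono) (auto simp: L_def)
    also have "\<dots> \<le> 1 / q"
      using hyps power_le_one[of q 3] by (simp add: field_simps power2_eq_square power3_eq_cube)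
    finally have "c\<^sup>2 \<le> a / (q * L)"
      using hyps L by (simp add: field_simps)
    then have "(c\<^sup>2) powr (1/3) \<le> X"
      unfolding X_def by (intro powr_mono2) auto
    then show ?thesis
      using hyps by (simp add: s_def powr_powr flip: powr_numeral)
  qed
  have N: "X \<le> N" "N > 0"
    using X by (auto simp: N_def real_nat_ceiling_ge)
  \<comment> \<open>The \<open>1\<close> lost by rounding up is absorbed into a multiple of
    \<open>X\<close>, because \<open>X\<close> is bounded below by \<open>s\<close>.\<close>
  have "N \<le> X + 1"
    using X by (simp add: N_def)
  also have "1 \<le> X / s"
    using \<open>s \<le> X\<close> s by simp
  finally have NX: "N \<le> X * (1 + 1 / s)"
    by (simp add: algebra_simps)
  have "a * (pi / N)\<^sup>2 / q \<le> 16 * T"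
  proof -
    have "a * (pi / N)\<^sup>2 / q \<le> a * (4 / X)\<^sup>2 / q"
      using hyps N X pi_less_4 by (intro divide_right_mono mult_left_mono power_mono frac_le) auto
    also have "\<dots> = 16 * (X ^ 3 * L) / X\<^sup>2"
      using hyps L unfolding X3 by (simp add: power_divide mult_ac)
    also have "\<dots> = 16 * T"
      using X by (simp add: T power3_eq_cube power2_eq_square)
    finally show ?thesis .
  qed
  then have V: "exp (a * (pi / N)\<^sup>2 / q) \<le> exp (16 * T)"
    by simp
  have "N * (\<kappa> * L) \<le> X * (1 + 1 / s) * (\<kappa> * L)"
    using NX hyps L by (intro mult_right_mono) auto
  moreover have "(2 * N) * (\<kappa> * ln n) = 2 * (N * (\<kappa> * L))"
    by (simp add: L_def)
  moreover have "2 * \<kappa> * (1 + 1 / s) * T = 2 * (X * (1 + 1 / s) * (\<kappa> * L))"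
    by (simp only: T mult_ac)
  ultimately have S: "exp (2 * N * (\<kappa> * ln n)) \<le> exp (2 * \<kappa> * (1 + 1 / s) * T)"
    unfolding exp_le_cancel_iff by linarith
  \<comment> \<open>The factor polynomial in \<open>a\<close> is absorbed because
    \<open>T ^ 3 = a * L\<^sup>2 / q\<close> is at least \<open>a / 4\<close>.\<close>
  have A: "1 + 2 * a \<le> exp (6 * T)"
  proof -
    have "a / 4 \<le> a * L\<^sup>2"
      using power_mono[OF L, of 2] hyps by (simp add: power_divide)
    also have "\<dots> \<le> a * L\<^sup>2 / q"
      using mult_left_mono[of q 1 "a * L\<^sup>2"] hyps by (simp only: pos_le_divide_eq) simp
    also have "\<dots> = T ^ 3"
      unfolding T power_mult_distrib X3 using L hyps by (simp add: power3_eq_cube power2_eq_square)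
    finally have "1 + 2 * a \<le> 1 + (2 * T) ^ 3"
      by (simp add: power_mult_distrib)
    also have "\<dots> \<le> (1 + 2 * T) ^ 3"
      using X L by (simp add: T power3_eq_cube algebra_simps)
    also have "\<dots> \<le> exp (2 * T) ^ 3"
      using X L by (intro power_mono exp_ge_add_one_self) (auto simp: T)
    also have "\<dots> = exp (6 * T)"
      by (simp add: exp_of_nat_mult[symmetric])
    finally show ?thesis .
  qed
  have "L \<le> T / s"
    using \<open>s \<le> X\<close> s L by (simp add: T field_simps)
  then have "n \<le> exp (T / s)"
    using hyps by (metis L_def exp_le_cancel_iff exp_ln of_nat_0_less_iff order_less_le_trans zero_less_numeral)
  moreover have "8 \<le> exp (12 * T)"
  proof -
    have "3 ^ 2 \<le> exp (6 * T) ^ 2"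
      using A hyps by (intro power_mono) linarith+
    then show ?thesis
      by (simp add: exp_of_nat_mult[symmetric])
  qed
  moreover have "real (a + 1) \<le> exp (6 * T)"
    using A by simp
  \<comment> \<open>The exponents \<open>12\<close>, \<open>6\<close> and \<open>16\<close> add up
    to the \<open>34\<close> in \<open>K\<close>; \<open>T / s\<close> pays for \<open>n\<close>,
    and the last factor for the separation.\<close>
  ultimately have "8 * real n * real (a + 1) * exp (a * (pi / N)\<^sup>2 / q) * exp (2 * N * (\<kappa> * ln n)) \<le>
      exp (12 * T) * exp (T / s) * exp (6 * T) * exp (16 * T) * exp (2 * \<kappa> * (1 + 1 / s) * T)"
    using V S by (intro mult_mono) auto
  also have "\<dots> = exp (K * T)"
    unfolding K_def s_def[symmetric] by (simp add: exp_add[symmetric] algebra_simps)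
  finally show ?thesis
    using that[OF N(2)] X L by (simp add: T)
qed

section \<open>Assembling the learner and its failure probability\<close>

theorem theorem7:
  fixes c C :: real and k l :: nat
  assumes "0 < c" and "0 < C"
  shows "\<exists>K>0. \<exists>\<delta> :: nat \<Rightarrow> real. \<delta> \<longlonglongrightarrow> 0 \<and>
    (\<forall>(n::nat) (a::nat) (q::real).
       2 \<le> n \<longrightarrow> 1 \<le> a \<longrightarrow> 0 < q \<longrightarrow> q \<le> 1 \<longrightarrow> c * sqrt (ln (real n) / real a) \<le> q \<longrightarrow>
       (\<exists>(m::nat) (learner :: nat list \<Rightarrow> (nat \<times> real) set).
          real m \<le> exp (K * ((real a / q) powr (1/3) * ln (real n) powr (2/3))) \<and>
          (\<forall>ps :: (nat \<times> real) list.
             mixture_params a ps \<longrightarrow> length ps \<le> n ^ k \<longrightarrow>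
             (\<forall>(b, \<alpha>) \<in> set ps. has_precision C (real n ^ l) \<alpha>) \<longrightarrow>
             measure_pmf.prob (replicate_pmf m (binomial_mixture q ps))
               {xs. learner xs = set ps} \<ge> 1 - \<delta> n)))"
proof -
  \<comment> \<open>Chosen so that \<open>2 * 10 ^ Y\<close> is at most \<open>n\<close> to the
    power \<open>\<kappa>\<close>: the summand \<open>1\<close> covers the \<open>2\<close>, the
    rest covers the denominator of the weights.\<close>
  define \<kappa> where "\<kappa> = 1 + C * l * ln 10"
  define K where "K = 34 + 1 / c powr (2/3) + 2 * \<kappa> * (1 + 1 / c powr (2/3))"
  have \<kappa>: "0 \<le> \<kappa>"
    using assms by (simp add: \<kappa>_def)
  have "0 < K"
    using \<kappa> by (auto simp: K_def intro!: add_pos_nonneg)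
  moreover have "(\<lambda>n. 1 / real n) \<longlonglongrightarrow> 0"
    by (rule lim_1_over_n)
  moreover have "\<exists>(m::nat) (learner :: nat list \<Rightarrow> (nat \<times> real) set).
      real m \<le> exp (K * ((real a / q) powr (1/3) * ln (real n) powr (2/3))) \<and>
      (\<forall>ps :: (nat \<times> real) list.
         mixture_params a ps \<longrightarrow> length ps \<le> n ^ k \<longrightarrow>
         (\<forall>(b, \<alpha>) \<in> set ps. has_precision C (real n ^ l) \<alpha>) \<longrightarrow>
         measure_pmf.prob (replicate_pmf m (binomial_mixture q ps))
           {xs. learner xs = set ps} \<ge> 1 - 1 / real n)"
    if n: "2 \<le> n" and a: "1 \<le> a" and q: "0 < q" "q \<le> 1" "c * sqrt (ln (real n) / real a) \<le> q"
    for n a :: nat and q :: real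
  proof -
    define T where "T = (real a / q) powr (1/3) * ln (real n) powr (2/3)"
    \<comment> \<open>The \<open>8\<close> is the \<open>4\<close> of the learner's failure bound
      times the \<open>2\<close> lost in rounding the sample size down; the factor \<open>n\<close>
      brings the failure probability to \<open>1 / n\<close>.\<close>
    obtain N :: nat where N: "N > 0" "0 < T"
        "8 * real n * real (a + 1) * exp (a * (pi / N)\<^sup>2 / q) * exp (2 * N * (\<kappa> * ln n)) \<le> exp (K * T)"
      using sample_size_estimate[OF \<open>0 < c\<close> \<kappa> n a q] unfolding T_def K_def .
    define Y where "Y = nat \<lfloor>C * ln (real n ^ l)\<rfloor>"
    define \<eta> :: real where "\<eta> = 1 / 10 ^ Y"
    define r where "r = 1 + (pi / N)\<^sup>2 / q\<^sup>2"
    define \<Delta> where "\<Delta> = ((\<eta> / 2) ^ N)\<^sup>2 / (a + 1)"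
    define V where "V = exp (a * (pi / N)\<^sup>2 / q)"
    define m where "m = nat \<lfloor>exp (K * T)\<rfloor>"
    define S where "S = {ps. mixture_params a ps \<and> (\<forall>(b, \<alpha>) \<in> set ps. has_precision C (real n ^ l) \<alpha>)}"
    \<comment> \<open>A real number that is at least \<open>1\<close> is at most twice its
      floor.\<close>
    have "1 \<le> exp (K * T)"
      using \<open>0 < K\<close> \<open>0 < T\<close> by simp
    then have "real m = of_int \<lfloor>exp (K * T)\<rfloor>" "1 \<le> \<lfloor>exp (K * T)\<rfloor>"
      unfolding m_def by (auto simp: le_floor_iff)
    then have m: "m > 0" "m \<le> exp (K * T)" "exp (K * T) / 2 \<le> m"
      by linarith+
    have "0 < \<eta>" "0 < \<Delta>"
      by (auto simp: \<eta>_def \<Delta>_def)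
    have supp: "set_pmf (pmf_of_list ps) \<subseteq> {..a}" if "ps \<in> S" for ps
      using that mixture_params_set_pmf[of a ps] by (auto simp: S_def mixture_params_def)
    have "\<exists>learner. \<forall>ps\<in>S. 1 - 4 * V / (\<Delta> * m) \<le>
        measure_pmf.prob (replicate_pmf m (binomial_mixture q ps)) {xs. learner xs = set ps}"
    proof (rule minimum_distance_learner[where w = "\<lambda>j. r ^ j"])
      show "0 \<le> r ^ j" for j
        by (simp add: r_def)
      show "set_pmf (binomial_mixture q ps) \<subseteq> {..a}" if "ps \<in> S" for ps
        unfolding binomial_mixture_def using q supp[OF that] by (intro set_bind_binomial_subset) auto
      show "(\<Sum>j\<le>a. r ^ j * pmf (binomial_mixture q ps) j) \<le> V" if "ps \<in> S" for ps
      proof -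
        have "a * q * (r - 1) = a * (pi / N)\<^sup>2 / q"
          using q by (simp add: r_def power2_eq_square)
        then show ?thesis
          using bind_binomial_moment_le[of q "pmf_of_list ps" a r] q supp[OF that]
          by (simp add: V_def r_def binomial_mixture_def)
      qed
      show "\<Delta> \<le> (\<Sum>j\<le>a. r ^ j * (pmf (binomial_mixture q ps) j - pmf (binomial_mixture q ps') j)\<^sup>2)"
        if "ps \<in> S" "ps' \<in> S" "set ps \<noteq> set ps'" for ps ps'
        unfolding \<Delta>_def r_def binomial_mixture_def
      proof (rule bind_binomial_separation)
        show "pmf_of_list ps \<noteq> pmf_of_list ps'"
          using that mixture_params_set_eq[of a] by (auto simp: S_def)
        show "\<eta> \<le> \<bar>pmf (pmf_of_list ps) b - pmf (pmf_of_list ps') b\<bar>"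
          if "pmf (pmf_of_list ps) b \<noteq> pmf (pmf_of_list ps') b" for b
          unfolding \<eta>_def Y_def
          using \<open>ps \<in> S\<close> \<open>ps' \<in> S\<close> that by (intro mixture_weights_gap[of a _ _ _ a]) (auto simp: S_def)
      qed (use q supp that \<open>0 < \<eta>\<close> \<open>N > 0\<close> in auto)
    qed (use \<open>0 < \<Delta>\<close> \<open>m > 0\<close> in auto)
    then obtain learner where learner: "\<And>ps. ps \<in> S \<Longrightarrow> 1 - 4 * V / (\<Delta> * m) \<le>
        measure_pmf.prob (replicate_pmf m (binomial_mixture q ps)) {xs. learner xs = set ps}"
      by blast
    have "1 / \<Delta> \<le> (a + 1) * exp (2 * N * (\<kappa> * ln n))"
    proof -
      have "real Y \<le> C * ln (real n ^ l)"
        using assms n unfolding Y_def by (intro of_nat_floor mult_nonneg_nonneg) (auto intro!: ln_ge_zero)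
      also have "\<dots> = C * l * ln n"
        using n by (simp add: ln_realpow)
      finally have "real Y * ln 10 \<le> C * l * ln n * ln 10"
        by (intro mult_right_mono) auto
      moreover have "ln 2 \<le> ln (real n)"
        using n by simp
      ultimately have "ln 2 + real Y * ln 10 \<le> \<kappa> * ln n"
        unfolding \<kappa>_def distrib_right mult_1_left by (simp only: mult_ac)
      then have "ln (2 * 10 ^ Y) \<le> \<kappa> * ln n"
        by (simp add: ln_mult ln_realpow)
      then have "2 * 10 ^ Y \<le> exp (\<kappa> * ln n)"
        by (subst (asm) exp_le_cancel_iff[symmetric]) simp
      then have "(2 * 10 ^ Y) ^ (2 * N) \<le> exp (\<kappa> * ln n) ^ (2 * N)"
        by (intro power_mono) auto
      also have "\<dots> = exp (2 * N * (\<kappa> * ln n))"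
        by (simp add: exp_of_nat_mult[symmetric])
      finally have "real (a + 1) * (2 * 10 ^ Y) ^ (2 * N) \<le> real (a + 1) * exp (2 * N * (\<kappa> * ln n))"
        by (intro mult_left_mono) auto
      moreover have "((\<eta> / 2) ^ N)\<^sup>2 = (1 / (2 * 10 ^ Y)) ^ (2 * N)"
        by (simp add: \<eta>_def power_mult[symmetric] mult.commute)
      then have "1 / \<Delta> = real (a + 1) * (2 * 10 ^ Y) ^ (2 * N)"
        by (simp only: \<Delta>_def power_one_over divide_divide_eq_right)
      ultimately show ?thesis
        by simp
    qed
    then have "8 * real n * V * (1 / \<Delta>) \<le> 8 * real n * V * (real (a + 1) * exp (2 * N * (\<kappa> * ln n)))"
      by (intro mult_left_mono) (auto simp: V_def)
    also have "\<dots> \<le> exp (K * T)"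
      using N(3) by (simp only: V_def mult_ac)
    also have "\<dots> \<le> 2 * m"
      using m by linarith
    finally have "4 * V / (\<Delta> * m) \<le> 1 / n"
      using \<open>0 < \<Delta>\<close> n m by (simp add: field_simps)
    then have "1 - 1 / real n \<le> measure_pmf.prob (replicate_pmf m (binomial_mixture q ps))
        {xs. learner xs = set ps}" if "ps \<in> S" for ps
      using learner[OF that] by linarith
    then show ?thesis
      using m(2) unfolding T_def S_def by blast
  qed
  ultimately show ?thesis
    by blast
qed

end
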